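(* Let $n$ and $w$ be positive integers. There is no $\mathrm{CGW}(n,w;6)$ when $n$ is odd and $w \equiv 6 \pmod 9$.
   Context: For a positive integer $k$, let $\zeta_k = e^{2\pi\sqrt{-1}/k}$ and $\mathcal{U}_k = \{0\} \cup \{\zeta_k^j : 0 \le j \le k-1\}$. A $\mathrm{CGW}(n,w;k)$ (complex generalized weighing matrix of order $n$ and weight $w$) is an $n \times n$ matrix $W$ with entries in $\mathcal{U}_k$ such that $WW^{*} = wI_n$, where $W^*$ is the complex conjugate transpose. *)

theory Defs
  imports
    "HOL-Number_Theory.Cong"
    "Jordan_Normal_Form.Schur_Decomposition"
begin

definition zeta :: "nat \<Rightarrow> complex" where
  "zeta k = exp (2 * of_real pi * \<i> / of_nat k)"

definition root_entries :: "nat \<Rightarrow> complex set" where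
  "root_entries k = {0} \<union> {zeta k ^ j | j. j < k}"

(* On complex matrices, mat_adjoint is the complex conjugate transpose. *)
definition is_CGW :: "nat \<Rightarrow> nat \<Rightarrow> nat \<Rightarrow> complex mat \<Rightarrow> bool" where
  "is_CGW n w k W \<longleftrightarrow>
     W \<in> carrier_mat n n \<and>
     elements_mat W \<subseteq> root_entries k \<and>
     W * mat_adjoint W = of_nat w \<cdot>\<^sub>m 1\<^sub>m n"

end

(* W W* = w I gives |det W|^2 = w^n, where det W lies in Z[zeta_6], so w^n is a norm
   a^2 + ab + b^2. Removing the powers of 3 (norms of powers of the ramified prime) from such a
   norm leaves a number that is not 2 mod 3, as a^2 + ab + b^2 = (a - b)^2 mod 3. But
   w = 3m with m = 2 mod 3, so for odd n removing 3^n from w^n leaves m^n = 2 mod 3. *)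
theory Submission
  imports Defs
begin

text \<open>Descent on \<open>j\<close>. For \<open>j = 0\<close> the form is a square modulo 3,
  hence 0 or 1. Otherwise 3 divides the form, and one factor 3 can be removed so that the quotient
  is again a value of the form.\<close>

lemma norm_form_div_3_power_mod_3:
  fixes a b m :: int
  assumes "a\<^sup>2 + a * b + b\<^sup>2 = 3 ^ j * m"
  shows "m mod 3 \<noteq> 2"
  using assms
proof (induction j arbitrary: a b)
  case 0
  have "m mod 3 = (a - b)\<^sup>2 mod 3"
  proof -
    have "m = (a - b)\<^sup>2 + 3 * (a * b)"
      using 0 by (simp add: power2_eq_square algebra_simps)
    then show ?thesis by simp
  qed
  also have "\<dots> = ((a - b) mod 3)\<^sup>2 mod 3"
    by (simp add: power_mod)
  also have "\<dots> \<noteq> 2"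
  proof -
    have "(a - b) mod 3 \<in> {0, 1, 2}" by auto
    then show ?thesis by auto
  qed
  finally show ?case .
next
  case (Suc j)
  have "(b - a)\<^sup>2 = 3 * (3 ^ j * m - a * b)"
    using Suc.prems by (simp add: power2_eq_square algebra_simps)
  then have "3 dvd (b - a)\<^sup>2" by simp
  then have "3 dvd b - a"
    using prime_dvd_power[of "3 :: int"] by auto
  then obtain c where "b - a = 3 * c" ..
  then have b: "b = a + 3 * c" by simp
  \<comment> \<open>The new pair comes from dividing by \<open>1 + zeta 6\<close>, which has norm 3:
    a + b zeta = (1 + zeta) ((a + c) + c zeta) when b = a + 3c.\<close>
  have "(a + c)\<^sup>2 + (a + c) * c + c\<^sup>2 = 3 ^ j * m"
    using Suc.prems unfolding b by (simp add: power2_eq_square algebra_simps)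
  then show ?case by (rule Suc.IH)
qed

text \<open>The ring Z[zeta_6], given by coordinates in the basis \<open>1\<close>,
  \<open>zeta 6\<close> so that norms become explicit integer forms.\<close>

definition eisenstein_ints :: "complex set" where
  "eisenstein_ints = {of_int a + of_int b * zeta 6 | a b. True}"

lemma zeta_6: "zeta 6 = Complex (1 / 2) (sqrt 3 / 2)"
proof -
  have "2 * of_real pi * \<i> / of_nat 6 = \<i> * of_real (pi / 3)"
    by simp
  then have "zeta 6 = cis (pi / 3)"
    unfolding zeta_def cis_conv_exp by (simp only:)
  then show ?thesis
    by (simp add: complex_eq_iff cos_60 sin_60)
qed

text \<open>The cyclotomic relation x^2 - x + 1 = 0, which brings products back to the basis
  \<open>1\<close>, \<open>zeta 6\<close>.\<close>

lemma zeta_6_square: "zeta 6 * zeta 6 = zeta 6 - 1"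
  by (simp add: zeta_6 complex_eq_iff field_simps)

lemma eisenstein_ints_of_int: "of_int a \<in> eisenstein_ints"
  unfolding eisenstein_ints_def by (intro CollectI exI[of _ a] exI[of _ 0]) simp

lemma eisenstein_ints_zeta: "zeta 6 \<in> eisenstein_ints"
  unfolding eisenstein_ints_def by (intro CollectI exI[of _ 0] exI[of _ 1]) simp

lemma eisenstein_ints_add:
  assumes "x \<in> eisenstein_ints" "y \<in> eisenstein_ints"
  shows "x + y \<in> eisenstein_ints"
proof -
  obtain a b c d where "x = of_int a + of_int b * zeta 6" "y = of_int c + of_int d * zeta 6"
    using assms unfolding eisenstein_ints_def by auto
  then have "x + y = of_int (a + c) + of_int (b + d) * zeta 6"
    by (simp add: algebra_simps)
  then show ?thesis unfolding eisenstein_ints_def by blast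
qed

lemma eisenstein_ints_mult:
  assumes "x \<in> eisenstein_ints" "y \<in> eisenstein_ints"
  shows "x * y \<in> eisenstein_ints"
proof -
  obtain a b c d where "x = of_int a + of_int b * zeta 6" "y = of_int c + of_int d * zeta 6"
    using assms unfolding eisenstein_ints_def by auto
  then have "x * y = of_int (a * c) + of_int (a * d + b * c) * zeta 6
      + of_int (b * d) * (zeta 6 * zeta 6)"
    by (simp add: algebra_simps)
  also have "\<dots> = of_int (a * c - b * d) + of_int (a * d + b * c + b * d) * zeta 6"
    unfolding zeta_6_square by (simp add: algebra_simps)
  finally show ?thesis unfolding eisenstein_ints_def by blast
qed

lemma eisenstein_ints_power: "x \<in> eisenstein_ints \<Longrightarrow> x ^ j \<in> eisenstein_ints"
  by (induction j) (use eisenstein_ints_of_int[of 1] in \<open>auto intro: eisenstein_ints_mult\<close>)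

lemma eisenstein_ints_sum:
  "(\<And>i. i \<in> A \<Longrightarrow> f i \<in> eisenstein_ints) \<Longrightarrow> sum f A \<in> eisenstein_ints"
  by (induction A rule: infinite_finite_induct)
    (use eisenstein_ints_of_int[of 0] in \<open>auto intro: eisenstein_ints_add\<close>)

lemma eisenstein_ints_prod:
  "(\<And>i. i \<in> A \<Longrightarrow> f i \<in> eisenstein_ints) \<Longrightarrow> prod f A \<in> eisenstein_ints"
  by (induction A rule: infinite_finite_induct)
    (use eisenstein_ints_of_int[of 1] in \<open>auto intro: eisenstein_ints_mult\<close>)

text \<open>By the Leibniz formula the determinant is a sum of signed products of entries, so
  closure under ring operations suffices.\<close>

lemma eisenstein_ints_det:
  assumes "A \<in> carrier_mat n n" "elements_mat A \<subseteq> eisenstein_ints"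
  shows "det A \<in> eisenstein_ints"
  unfolding det_def'[OF assms(1)]
proof (intro eisenstein_ints_sum eisenstein_ints_mult eisenstein_ints_prod)
  fix p
  show "signof p \<in> eisenstein_ints"
    using eisenstein_ints_of_int[of "sign p"] by simp
next
  fix p i assume "p \<in> {p. p permutes {0..<n}}" "i \<in> {0..<n}"
  then have "A $$ (i, p i) \<in> elements_mat A"
    using assms(1) by (force simp: elements_mat_def permutes_in_image)
  then show "A $$ (i, p i) \<in> eisenstein_ints" using assms(2) by auto
qed

lemma root_entries_6_subset: "root_entries 6 \<subseteq> eisenstein_ints"
  using eisenstein_ints_of_int[of 0]
  by (auto simp: root_entries_def intro: eisenstein_ints_power eisenstein_ints_zeta)

text \<open>Since \<open>zeta 6\<close> and its conjugate have sum 1 and product 1, the cross term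
  of the norm is exactly \<open>a * b\<close>.\<close>

lemma eisenstein_ints_norm:
  assumes "x \<in> eisenstein_ints"
  obtains a b :: int where "x * cnj x = of_int (a\<^sup>2 + a * b + b\<^sup>2)"
proof -
  obtain a b where x: "x = of_int a + of_int b * zeta 6"
    using assms unfolding eisenstein_ints_def by auto
  have "x * cnj x = of_int (a\<^sup>2 + a * b + b\<^sup>2)"
    unfolding x zeta_6 by (simp add: complex_eq_iff power2_eq_square field_simps)
  then show ?thesis by (rule that)
qed

text \<open>Conjugation is a ring homomorphism, so it commutes with \<open>det\<close>, and
  transposing does not change \<open>det\<close>.\<close>

lemma det_mat_adjoint:
  fixes A :: "complex mat"
  assumes "A \<in> carrier_mat n n"
  shows "det (mat_adjoint A) = cnj (det A)"
proof -
  interpret cnj: comm_ring_hom cnj by unfold_locales auto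
  have "mat_adjoint A = transpose_mat (map_mat cnj A)"
    using assms by (intro eq_matI) (auto simp: mat_adjoint_def mat_of_rows_def)
  moreover have "map_mat cnj A \<in> carrier_mat n n" using assms by simp
  ultimately show ?thesis by (simp add: det_transpose cnj.hom_det)
qed

theorem proposition2p8:
  fixes n w :: nat
  assumes "n > 0" and "w > 0"
    and "odd n"
    and "[w = 6] (mod 9)"
  shows "\<not> (\<exists>W. is_CGW n w 6 W)"
proof
  assume "\<exists>W. is_CGW n w 6 W"
  then obtain W where W: "W \<in> carrier_mat n n" "elements_mat W \<subseteq> root_entries 6"
    "W * mat_adjoint W = of_nat w \<cdot>\<^sub>m 1\<^sub>m n"
    unfolding is_CGW_def by auto
  have "mat_adjoint W \<in> carrier_mat n n"
    using W(1) by (auto simp: mat_adjoint_def)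
  then have "det W * cnj (det W) = det (W * mat_adjoint W)"
    using W(1) by (simp add: det_mult det_mat_adjoint)
  also have "\<dots> = of_nat w ^ n"
    unfolding W(3) by simp
  finally have norm: "det W * cnj (det W) = of_nat w ^ n" .
  have "det W \<in> eisenstein_ints"
    using eisenstein_ints_det W root_entries_6_subset by blast
  then obtain a b :: int where "det W * cnj (det W) = of_int (a\<^sup>2 + a * b + b\<^sup>2)"
    by (rule eisenstein_ints_norm)
  then have "of_int (a\<^sup>2 + a * b + b\<^sup>2) = (of_int (int w ^ n) :: complex)"
    unfolding norm by simp
  then have form: "a\<^sup>2 + a * b + b\<^sup>2 = int w ^ n"
    by (simp only: of_int_eq_iff)
  define m where "m = int w div 3"
  have "w mod 9 = 6" using assms(4) by (simp add: cong_def)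
  \<comment> \<open>The residue modulo 9, not just modulo 3, is what determines \<open>m\<close>
    modulo 3.\<close>
  then have w: "int w = 3 * m" and m: "m mod 3 = 2"
    unfolding m_def by presburger+
  have "a\<^sup>2 + a * b + b\<^sup>2 = 3 ^ n * m ^ n"
    using form w by (simp add: power_mult_distrib)
  then have "m ^ n mod 3 \<noteq> 2"
    by (rule norm_form_div_3_power_mod_3)
  \<comment> \<open>As 2 is -1 modulo 3 and \<open>n\<close> is odd, \<open>m ^ n\<close> is again 2
    modulo 3, the excluded residue.\<close>
  moreover have "[m ^ n = (- 1) ^ n] (mod 3)"
    using m by (intro cong_pow) (simp add: cong_def)
  ultimately show False
    using \<open>odd n\<close> by (simp add: cong_def)
qed

end
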